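(* Any $(S,w)$-gap shift $X_w(S)$ is synchronized with synchronizing word $0$.
   Context: Let $S\subseteq\mathbb{Z}_{\geq 0}$ and let $w\in\{1,2,\dots,k\}^{\mathbb{Z}}$, where $k>0$ is an integer. A word over an alphabet is a finite sequence of letters; $|u|$ denotes the length of the word $u$, and $\epsilon$ is the empty word, with $|\epsilon|=0$. A nonempty word $u$ appears in a bi-infinite sequence $x=(x_i)_{i\in\mathbb{Z}}$ if $u=x_ix_{i+1}\cdots x_j$ for some integers $i\le j$; the empty word is regarded as appearing in every sequence. The $(S,w)$-gap shift is $$X_w(S)=\overline{\{\ldots 0\,u_{-1}\,0\,u_0\,0\,u_1\,0\ldots : u_i \text{ appears in } w,\ |u_i|\in S \text{ for all } i\in\mathbb{Z}\}}\subseteq\{0,1,\dots,k\}^{\mathbb{Z}},$$ i.e. the closure (in the product topology of the discrete topology) of the set of all bi-infinite concatenations, positioned arbitrarily, in which consecutive $0$'s are separated by words $u_i$ appearing in $w$ with $|u_i|\in S$ (the words $u_i$ may be chosen freely and independently). For a shift space $X$, the language $\mathcal{B}(X)$ is the set of all words (of any length $n\ge 0$) appearing in some point of $X$. A word $v\in\mathcal{B}(X)$ is synchronizing for $X$ if for all words $u,u'$: $uv\in\mathcal{B}(X)$ and $vu'\in\mathcal{B}(X)$ imply $uvu'\in\mathcal{B}(X)$. The shift $X$ is synchronized if $\mathcal{B}(X)$ contains a synchronizing word.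
   Formalization: The set S is assumed nonempty; for S empty the gap shift and its language are empty, so 0 is not in the language and the claim fails. *)

theory Defs
  imports "HOL-Analysis.Abstract_Topology" "HOL-Analysis.Function_Topology"
begin

text \<open>Words are lists and bi-infinite sequences are functions on \<^typ>\<open>int\<close>.\<close>

definition appears_in :: "'a list \<Rightarrow> (int \<Rightarrow> 'a) \<Rightarrow> bool" where
  "appears_in u x \<longleftrightarrow> u = [] \<or> (\<exists>i j. i \<le> j \<and> u = map x [i..j])"

definition language :: "(int \<Rightarrow> 'a) set \<Rightarrow> 'a list set" where
  "language X = {v. \<exists>x\<in>X. appears_in v x}"

definition synchronizing_word :: "(int \<Rightarrow> 'a) set \<Rightarrow> 'a list \<Rightarrow> bool" where
  "synchronizing_word X v \<longleftrightarrow> v \<in> language X \<and>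
     (\<forall>u u'. u @ v \<in> language X \<longrightarrow> v @ u' \<in> language X \<longrightarrow> u @ v @ u' \<in> language X)"

definition synchronized :: "(int \<Rightarrow> 'a) set \<Rightarrow> bool" where
  "synchronized X \<longleftrightarrow> (\<exists>v. synchronizing_word X v)"

text \<open>The points \<open>\<dots> 0 u\<^sub>-\<^sub>1 0 u\<^sub>0 0 u\<^sub>1 0 \<dots>\<close>: the block \<open>0 u\<^sub>n\<close> occupies the positions
  from \<open>p n\<close> up to, but excluding, \<open>p (n + 1)\<close>. As \<open>p\<close> increases strictly over all of
  \<^typ>\<open>int\<close>, the blocks cover every position; the value \<open>p 0\<close> is unconstrained, so
  all shifts of a concatenation are included.\<close>

definition gap_points :: "nat set \<Rightarrow> (int \<Rightarrow> nat) \<Rightarrow> (int \<Rightarrow> nat) set" where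
  "gap_points S w = {x. \<exists>(u :: int \<Rightarrow> nat list) (p :: int \<Rightarrow> int). \<forall>n.
     appears_in (u n) w \<and> length (u n) \<in> S \<and>
     p (n + 1) = p n + 1 + int (length (u n)) \<and>
     map x [p n..p (n + 1) - 1] = 0 # u n}"

definition gap_shift :: "nat \<Rightarrow> nat set \<Rightarrow> (int \<Rightarrow> nat) \<Rightarrow> (int \<Rightarrow> nat) set" where
  "gap_shift k S w =
     (product_topology (\<lambda>_. discrete_topology {0..k}) UNIV) closure_of (gap_points S w)"

end

theory Submission
  imports Defs
begin

text \<open>Points of the closure have the same finite words as the concatenations themselves. In a
  concatenation the symbol 0 occurs exactly at the block boundaries, since \<open>w\<close> avoids 0. Hence two
  concatenations that both carry 0 at position \<open>a\<close> can be spliced at \<open>a\<close>, and the result is again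
  a concatenation.\<close>

section \<open>Finite words and the topological closure\<close>

lemma appears_in_iff: "appears_in v x \<longleftrightarrow> (\<exists>i j. v = map x [i..j])"
proof
  assume "appears_in v x"
  then show "\<exists>i j. v = map x [i..j]"
    unfolding appears_in_def
  proof
    assume "v = []"
    then have "v = map x [1..0]"
      by simp
    then show ?thesis
      by blast
  qed blast
next
  assume "\<exists>i j. v = map x [i..j]"
  then show "appears_in v x"
    unfolding appears_in_def by (metis list.map_disc_iff not_le upto_empty)
qed

lemma in_language_iff: "v \<in> language X \<longleftrightarrow> (\<exists>x\<in>X. \<exists>i j. v = map x [i..j])"
  by (simp add: language_def appears_in_iff)

lemma set_subset_range_if_appears_in: "appears_in v x \<Longrightarrow> set v \<subseteq> range x"
  by (auto simp: appears_in_def)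

lemma map_upto_shift: "map (\<lambda>l. x (l + c)) [i..j] = map x [i + c..j + c]"
  for i j c :: int
  by (rule nth_equalityI) (auto simp: algebra_simps)

text \<open>A word occupies a finite window, and fixing finitely many coordinates of a point gives
  an open neighbourhood of it. That neighbourhood meets \<open>G\<close>, so some point of
  \<open>G\<close> shows the same word.\<close>

lemma language_closure_of_discrete:
  "language (product_topology (\<lambda>_. discrete_topology A) UNIV closure_of G) \<subseteq> language G"
proof
  fix v assume "v \<in> language (product_topology (\<lambda>_. discrete_topology A) UNIV closure_of G)"
  then obtain x i j where x: "x \<in> product_topology (\<lambda>_. discrete_topology A) UNIV closure_of G"
    and v: "v = map x [i..j]"
    unfolding in_language_iff by blast
  define J where "J = {i..j}"
  \<comment> \<open>The cylinder of \<open>x\<close> over the window \<open>J\<close>: only the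
    finitely many factors in \<open>J\<close> differ from \<open>A\<close>, so it is a basic open
    set.\<close>
  define U where "U = (\<Pi>\<^sub>E l\<in>UNIV. if l \<in> J then {x l} else A)"
  have xA: "x l \<in> A" for l
    using x by (auto simp: in_closure_of PiE_iff)
  have "openin (product_topology (\<lambda>_. discrete_topology A) UNIV) U"
    unfolding U_def
  proof (rule product_topology_basis)
    show "finite {l. (if l \<in> J then {x l} else A) \<noteq> topspace (discrete_topology A)}"
      by (rule finite_subset[of _ J]) (auto simp: J_def)
  qed (use xA in auto)
  moreover have "x \<in> U"
    using xA by (auto simp: U_def)
  ultimately obtain y where "y \<in> G" "y \<in> U"
    using x by (auto simp: in_closure_of)
  have "y l = x l" if "l \<in> J" for l
    using PiE_mem[OF \<open>y \<in> U\<close>[unfolded U_def], of l] that by simp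
  then have "v = map y [i..j]"
    by (auto simp: v J_def)
  with \<open>y \<in> G\<close> show "v \<in> language G"
    unfolding in_language_iff by blast
qed

lemma language_mono: "X \<subseteq> Y \<Longrightarrow> language X \<subseteq> language Y"
  by (auto simp: language_def)

section \<open>Block decompositions of concatenations\<close>

text \<open>Exposes the witnesses behind \<open>gap_points\<close>, so that they can be reindexed,
  shifted and glued. The block end is written through \<open>length (u n)\<close>, so that only the
  recursion for \<open>p\<close> links two indices.\<close>

definition gap_parse ::
  "nat set \<Rightarrow> (int \<Rightarrow> nat) \<Rightarrow> (int \<Rightarrow> nat) \<Rightarrow> (int \<Rightarrow> nat list) \<Rightarrow> (int \<Rightarrow> int) \<Rightarrow> bool" where
  "gap_parse S w x u p \<longleftrightarrow> (\<forall>n.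
     appears_in (u n) w \<and> length (u n) \<in> S \<and>
     p (n + 1) = p n + 1 + int (length (u n)) \<and>
     map x [p n..p n + int (length (u n))] = 0 # u n)"

lemma gap_points_iff: "x \<in> gap_points S w \<longleftrightarrow> (\<exists>u p. gap_parse S w x u p)"
  by (simp add: gap_points_def gap_parse_def cong: conj_cong)

lemma gap_parse_reindex:
  assumes "gap_parse S w x u p"
  shows "gap_parse S w x (\<lambda>n. u (n + c)) (\<lambda>n. p (n + c))"
  unfolding gap_parse_def
proof
  fix n
  have "n + 1 + c = n + c + 1"
    by simp
  then show "appears_in (u (n + c)) w \<and> length (u (n + c)) \<in> S \<and>
     p (n + 1 + c) = p (n + c) + 1 + int (length (u (n + c))) \<and>
     map x [p (n + c)..p (n + c) + int (length (u (n + c)))] = 0 # u (n + c)"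
    using assms[unfolded gap_parse_def, rule_format, of "n + c"] by (simp only:)
qed

lemma gap_parse_shift:
  assumes "gap_parse S w x u p"
  shows "gap_parse S w (\<lambda>l. x (l + c)) u (\<lambda>n. p n - c)"
  unfolding gap_parse_def
proof
  fix n
  from assms[unfolded gap_parse_def, rule_format, of n]
  show "appears_in (u n) w \<and> length (u n) \<in> S \<and>
     p (n + 1) - c = p n - c + 1 + int (length (u n)) \<and>
     map (\<lambda>l. x (l + c)) [p n - c..p n - c + int (length (u n))] = 0 # u n"
    by (simp add: map_upto_shift algebra_simps)
qed

lemma gap_points_shift: "x \<in> gap_points S w \<Longrightarrow> (\<lambda>l. x (l + c)) \<in> gap_points S w"
  unfolding gap_points_iff using gap_parse_shift by blast

lemma gap_parse_strict_mono:
  assumes "gap_parse S w x u p"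
  shows "strict_mono p"
proof (rule strict_monoI)
  have step: "p n < p (n + 1)" for n
    using assms[unfolded gap_parse_def, rule_format, of n] by linarith
  fix m n :: int assume "m < n"
  then show "p m < p n"
  proof (induction n rule: int_gr_induct)
    case (step i)
    then show ?case
      using \<open>\<And>n. p n < p (n + 1)\<close>[of i] by linarith
  qed (rule step)
qed

text \<open>Each step raises \<open>p\<close> by at least 1, so \<open>p\<close> is unbounded in
  both directions and must cross \<open>l\<close> somewhere.\<close>

lemma strict_mono_int_cover:
  fixes p :: "int \<Rightarrow> int"
  assumes "strict_mono p"
  obtains n where "p n \<le> l" "l < p (n + 1)"
proof -
  have up: "p 0 + int m \<le> p (int m)" for m
  proof (induction m)
    case (Suc m)
    have "p (int m) < p (int (Suc m))"
      by (rule strict_monoD[OF assms]) simp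
    with Suc show ?case by simp
  qed simp
  have down: "p (- int m) \<le> p 0 - int m" for m
  proof (induction m)
    case (Suc m)
    have "p (- int (Suc m)) < p (- int m)"
      by (rule strict_monoD[OF assms]) simp
    with Suc show ?case by simp
  qed simp
  define a where "a = - int (nat \<bar>l - p 0\<bar>)"
  define b where "b = int (nat \<bar>l - p 0\<bar> + 1)"
  have "a \<le> b" "p a \<le> l" "l < p b"
    using down[of "nat \<bar>l - p 0\<bar>"] up[of "nat \<bar>l - p 0\<bar> + 1"]
    unfolding a_def b_def by simp_all
  \<comment> \<open>Induction on \<open>b\<close> with \<open>a\<close> fixed finds the crossing;
    the base case \<open>b = a\<close> contradicts \<open>p a \<le> l < p a\<close>.\<close>
  then have "\<exists>n. p n \<le> l \<and> l < p (n + 1)"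
  proof (induction b rule: int_ge_induct)
    case (step i)
    then show ?case
      by (cases "l < p i") (auto simp: not_less)
  qed auto
  with that show thesis by blast
qed

lemma gap_parse_start:
  assumes "gap_parse S w x u p"
  shows "x (p n) = 0"
proof -
  have "map x [p n..p n + int (length (u n))] = 0 # u n"
    using assms unfolding gap_parse_def by blast
  then show ?thesis
    by (simp add: upto_rec1)
qed

text \<open>If \<open>w\<close> avoids 0, this leaves the block starts as the only positions of
  0.\<close>

lemma gap_parse_inside:
  assumes P: "gap_parse S w x u p" and "p n < l" "l < p (n + 1)"
  shows "x l \<in> range w"
proof -
  have u: "appears_in (u n) w" "p (n + 1) = p n + 1 + int (length (u n))"
    "map x [p n..p n + int (length (u n))] = 0 # u n"
    using P unfolding gap_parse_def by blast+
  then have "u n = map x [p n + 1..p n + int (length (u n))]"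
    by (simp add: upto_rec1)
  moreover have "l \<in> {p n + 1..p n + int (length (u n))}"
    using assms(2,3) u(2) by simp
  ultimately have "x l \<in> set (u n)"
    by (metis imageI list.set_map set_upto)
  then show ?thesis
    using set_subset_range_if_appears_in[OF u(1)] by blast
qed

lemma gap_points_range:
  assumes "x \<in> gap_points S w"
  shows "x l \<in> insert 0 (range w)"
proof -
  obtain u p where P: "gap_parse S w x u p"
    using assms by (auto simp: gap_points_iff)
  obtain n where "p n \<le> l" "l < p (n + 1)"
    using strict_mono_int_cover gap_parse_strict_mono[OF P] .
  then show ?thesis
    using gap_parse_start[OF P, of n] gap_parse_inside[OF P, of n l] by (cases "l = p n") auto
qed

text \<open>A 0 must start a block, and renumbering the blocks gives that one index 0. This
  normalization lets two parses be glued index by index.\<close>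

lemma gap_points_parse_at_zero:
  assumes "x \<in> gap_points S w" "x a = 0" "0 \<notin> range w"
  obtains u p where "gap_parse S w x u p" "p 0 = a"
proof -
  obtain u p where P: "gap_parse S w x u p"
    using assms(1) by (auto simp: gap_points_iff)
  obtain n where n: "p n \<le> a" "a < p (n + 1)"
    using strict_mono_int_cover gap_parse_strict_mono[OF P] .
  \<comment> \<open>Otherwise \<open>a\<close> lies strictly inside block \<open>n\<close>, and 0
    would be a letter of \<open>w\<close>.\<close>
  have "p n = a"
    using gap_parse_inside[OF P, of n a] n assms(2,3) by force
  with that gap_parse_reindex[OF P, of n] show thesis
    by simp
qed

section \<open>Splicing at a common 0\<close>

text \<open>With block 0 starting at \<open>a\<close> in both parses, the negative blocks of
  \<open>x\<close> followed by the remaining blocks of \<open>y\<close> parse the spliced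
  point.\<close>

lemma gap_points_splice:
  assumes x: "x \<in> gap_points S w" "x a = 0" and y: "y \<in> gap_points S w" "y a = 0"
    and w: "0 \<notin> range w"
  shows "(\<lambda>l. if l \<le> a then x l else y l) \<in> gap_points S w"
proof -
  obtain u p where P: "gap_parse S w x u p" "p 0 = a"
    using gap_points_parse_at_zero x w .
  obtain v q where Q: "gap_parse S w y v q" "q 0 = a"
    using gap_points_parse_at_zero y w .
  define z where "z = (\<lambda>l. if l \<le> a then x l else y l)"
  define r where "r = (\<lambda>n. if n < 0 then p n else q n)"
  define t where "t = (\<lambda>n. if n < 0 then u n else v n)"
  have "gap_parse S w z t r"
    unfolding gap_parse_def
  proof
    fix n
    show "appears_in (t n) w \<and> length (t n) \<in> S \<and>
     r (n + 1) = r n + 1 + int (length (t n)) \<and> map z [r n..r n + int (length (t n))] = 0 # t n"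
    proof (cases "n < 0")
      case True
      have step: "p (n + 1) = p n + 1 + int (length (u n))"
        using P(1) unfolding gap_parse_def by blast
      \<comment> \<open>At the seam \<open>n = -1\<close>, \<open>r 0\<close> is \<open>q 0\<close>,
        which equals \<open>p 0\<close> because both are \<open>a\<close>.\<close>
      have r: "r n = p n" "r (n + 1) = p (n + 1)"
        using True P(2) Q(2) by (cases "n = -1"; simp add: r_def)+
      have "p (n + 1) \<le> a"
        using strict_mono_less_eq[OF gap_parse_strict_mono[OF P(1)], of "n + 1" 0] True P(2) by simp
      with step have "map z [p n..p n + int (length (u n))] = map x [p n..p n + int (length (u n))]"
        by (auto simp: z_def)
      with P(1)[unfolded gap_parse_def, rule_format, of n] True r show ?thesis
        by (simp add: t_def)
    next
      case False
      then have r: "r n = q n" "r (n + 1) = q (n + 1)"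
        by (auto simp: r_def)
      have "a \<le> q n"
        using strict_mono_less_eq[OF gap_parse_strict_mono[OF Q(1)], of 0 n] False Q(2) by simp
      \<comment> \<open>At position \<open>a\<close> itself \<open>z\<close> takes its value from
        \<open>x\<close>, but both points carry 0 there.\<close>
      then have "map z [q n..q n + int (length (v n))] = map y [q n..q n + int (length (v n))]"
        using x(2) y(2) by (auto simp: z_def dest: order_trans order_antisym)
      with Q(1)[unfolded gap_parse_def, rule_format, of n] False r show ?thesis
        by (simp add: t_def)
    qed
  qed
  then show ?thesis
    by (auto simp: gap_points_iff z_def)
qed

section \<open>Nonemptiness and the language of the gap shift\<close>

lemma gap_points_nonempty:
  assumes "s \<in> S"
  shows "gap_points S w \<noteq> {}"
proof -
  define N where "N = int s + 1"
  \<comment> \<open>The periodic point repeating the block \<open>0 w(1) ... w(s)\<close>, of period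
    \<open>N = s + 1\<close>; for \<open>s = 0\<close> it is constantly 0.\<close>
  define x where "x = (\<lambda>l. if l mod N = 0 then 0 else w (l mod N))"
  have "gap_parse S w x (\<lambda>_. map w [1..int s]) (\<lambda>n. n * N)"
    unfolding gap_parse_def
  proof (intro allI conjI)
    fix n
    show "appears_in (map w [1..int s]) w"
      unfolding appears_in_iff by blast
    show "length (map w [1..int s]) \<in> S"
      using assms by simp
    show "(n + 1) * N = n * N + 1 + int (length (map w [1..int s]))"
      by (simp add: N_def algebra_simps)
    have "map x [n * N..n * N + int (length (map w [1..int s]))] = map (\<lambda>l. x (l + n * N)) [0..int s]"
      by (simp add: map_upto_shift add.commute)
    also have "\<dots> = map x [0..int s]"
      by (simp add: x_def)
    also have "\<dots> = x 0 # map x [1..int s]"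
      by (simp add: upto_rec1[of 0])
    also have "map x [1..int s] = map w [1..int s]"
      by (simp add: x_def N_def)
    also have "x 0 = 0"
      by (simp add: x_def)
    finally show "map x [n * N..n * N + int (length (map w [1..int s]))] = 0 # map w [1..int s]" .
  qed
  then show ?thesis
    by (metis empty_iff gap_points_iff)
qed

text \<open>Closing up adds no words. Conversely, the bound on \<open>w\<close> puts the
  concatenations into the full shift over \<open>{0..k}\<close>, hence into their closure
  there.\<close>

lemma language_gap_shift:
  assumes "range w \<subseteq> {0..k}"
  shows "language (gap_shift k S w) = language (gap_points S w)"
proof
  show "language (gap_shift k S w) \<subseteq> language (gap_points S w)"
    unfolding gap_shift_def by (rule language_closure_of_discrete)
  have "gap_points S w \<subseteq> gap_shift k S w"
    unfolding gap_shift_def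
  proof (rule closure_of_subset)
    show "gap_points S w \<subseteq> topspace (product_topology (\<lambda>_. discrete_topology {0..k}) UNIV)"
    proof
      fix x assume "x \<in> gap_points S w"
      then have "x l \<in> {0..k}" for l
        using gap_points_range[of x S w l] assms by auto
      then show "x \<in> topspace (product_topology (\<lambda>_. discrete_topology {0..k}) UNIV)"
        by (simp add: PiE_iff)
    qed
  qed
  then show "language (gap_points S w) \<subseteq> language (gap_shift k S w)"
    by (rule language_mono)
qed

lemma zero_in_language_gap_points:
  assumes "S \<noteq> {}"
  shows "[0] \<in> language (gap_points S w)"
proof -
  obtain x u p where "x \<in> gap_points S w" and P: "gap_parse S w x u p"
    using assms gap_points_nonempty by (metis all_not_in_conv gap_points_iff)
  have "[0] = map x [p 0..p 0]"
    using gap_parse_start[OF P] by simp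
  with \<open>x \<in> gap_points S w\<close> show ?thesis
    unfolding in_language_iff by metis
qed

section \<open>Synchronization by the word 0\<close>

lemma synchronizing_word_zero_gap_points:
  assumes "S \<noteq> {}" "0 \<notin> range w"
  shows "synchronizing_word (gap_points S w) [0]"
  unfolding synchronizing_word_def
proof (intro conjI allI impI)
  show "[0] \<in> language (gap_points S w)"
    using assms(1) by (rule zero_in_language_gap_points)
  fix v v'
  assume "v @ [0] \<in> language (gap_points S w)"
  then obtain x i a where x: "x \<in> gap_points S w" and "i \<le> a" and v: "v @ [0] = map x [i..a]"
    by (auto simp: language_def appears_in_def)
  assume "[0] @ v' \<in> language (gap_points S w)"
  then obtain y j b' where y: "y \<in> gap_points S w" and "j \<le> b'" and v': "0 # v' = map y [j..b']"
    by (auto simp: language_def appears_in_def)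
  define b where "b = a + (b' - j)"
  \<comment> \<open>Translates \<open>y\<close> so that the 0 at \<open>j\<close>, the start of its
    window, lands on \<open>a\<close>, where the window of \<open>x\<close> ends in 0;
    \<open>b\<close> is the translate of \<open>b'\<close>.\<close>
  define y' where "y' = (\<lambda>l. y (l + (j - a)))"
  define z where "z = (\<lambda>l. if l \<le> a then x l else y' l)"
  have "a \<le> b"
    using \<open>j \<le> b'\<close> by (simp add: b_def)
  have "map x [i..a - 1] @ [x a] = v @ [0]"
    using v \<open>i \<le> a\<close> by (simp add: upto_rec2)
  then have xv: "map x [i..a - 1] = v" "x a = 0"
    by auto
  have "map y' [a..b] = 0 # v'"
    unfolding y'_def map_upto_shift v' by (simp add: b_def)
  then have yv: "y' a = 0" "map y' [a + 1..b] = v'"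
    using \<open>a \<le> b\<close> by (simp_all add: upto_rec1)
  have "z \<in> gap_points S w"
    unfolding z_def y'_def
    by (rule gap_points_splice) (use x y xv yv assms in \<open>auto simp: y'_def intro: gap_points_shift\<close>)
  moreover have "map z [i..b] = v @ [0] @ v'"
  proof -
    have "[i..b] = [i..a - 1] @ a # [a + 1..b]"
      using \<open>i \<le> a\<close> \<open>a \<le> b\<close> by (rule upto_split3)
    moreover have "map z [i..a - 1] = map x [i..a - 1]" "map z [a + 1..b] = map y' [a + 1..b]"
      by (auto simp: z_def)
    ultimately show ?thesis
      using xv yv by (simp add: z_def)
  qed
  ultimately show "v @ [0] @ v' \<in> language (gap_points S w)"
    unfolding in_language_iff by metis
qed

theorem proposition4p4:
  fixes k :: nat and S :: "nat set" and w :: "int \<Rightarrow> nat"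
  assumes "k > 0" and "\<And>i. w i \<in> {1..k}" and "S \<noteq> {}"
  shows "synchronized (gap_shift k S w) \<and> synchronizing_word (gap_shift k S w) [0]"
proof -
  have "range w \<subseteq> {0..k}" "0 \<notin> range w"
    using assms(2) by (auto, metis atLeastAtMost_iff not_one_le_zero)
  \<comment> \<open>Being synchronizing depends on the language alone, so the property passes from
    the concatenations to their closure.\<close>
  then have "synchronizing_word (gap_shift k S w) [0]"
    using synchronizing_word_zero_gap_points[OF assms(3)]
    by (simp add: synchronizing_word_def language_gap_shift)
  then show ?thesis
    unfolding synchronized_def by blast
qed

end
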